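(* Let $\Phi\in\mathbb{R}^{n\times p}$, let $z\in\mathbb{R}^n$ and let $\hat{x}:\mathbb{R}^n\to\mathbb{R}^p$ be differentiable at $z$. Write $J=J_{\hat{x}}(z)\in\mathbb{R}^{p\times n}$ for the Jacobian matrix of $\hat{x}$ at $z$ and $\delta=z-\Phi\hat{x}(z)$. Then a guess based covariant least-square re-fitting $\mathcal{D}_{\hat{x},z}$ of $\hat{x}$ for $z$ exists; it is unique if $\Phi J\delta\neq 0$; and it is given, for all $y\in\mathbb{R}^n$, by $$\mathcal{D}_{\hat{x},z}(y)=\hat{x}(z)+\rho J(y-\Phi\hat{x}(z)),\qquad \rho=\begin{cases}\dfrac{\langle \Phi J\delta,\delta\rangle}{\|\Phi J\delta\|_2^2}&\text{if }\Phi J\delta\neq 0,\\ 1&\text{otherwise}\end{cases}$$ (when $\Phi J\delta=0$, this means that the displayed map is one of the guess based covariant least-square re-fittings of $\hat{x}$ for $z$).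
   Context: Definition. Let $\Phi\in\mathbb{R}^{n\times p}$ and let $\hat{x}:\mathbb{R}^n\to\mathbb{R}^p$ be differentiable at $z\in\mathbb{R}^n$. A map $\mathcal{D}_{\hat{x},z}:\mathbb{R}^n\to\mathbb{R}^p$ is a guess based covariant least-square re-fitting of $\hat{x}$ for $z$ if $$\mathcal{D}_{\hat{x},z}\in\operatorname{argmin}_{h\in\mathcal{H}}\|\Phi h(z)-z\|_2^2,$$ where $\mathcal{H}$ is the set of maps $h:\mathbb{R}^n\to\mathbb{R}^p$ satisfying: (1) affine map: there are $A\in\mathbb{R}^{p\times n}$, $b\in\mathbb{R}^p$ with $h(y)=Ay+b$ for all $y\in\mathbb{R}^n$; (2) covariant preserving: $J_h(z)=\rho J_{\hat{x}}(z)$ for some $\rho\in\mathbb{R}$, where $J_h(z)$ denotes the Jacobian matrix of $h$ at $z$; (3) coherent map: $h(\Phi\hat{x}(z))=\hat{x}(z)$. *)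

theory Defs
  imports "HOL-Analysis.Analysis"
begin

text \<open>
  A matrix with \<open>n\<close> rows and \<open>p\<close> columns has type \<open>real ^ 'p ^ 'n\<close>. The library's
  \<open>jacobian h (at z)\<close> carries information only where \<open>h\<close> is differentiable; this holds
  automatically for the affine maps \<open>h\<close> below, and has to be assumed of \<open>xhat\<close>.
\<close>

definition affine_map :: "(real ^ 'n \<Rightarrow> real ^ 'p) \<Rightarrow> bool" where
  "affine_map h \<longleftrightarrow> (\<exists>(A :: real ^ 'n ^ 'p) b. \<forall>y. h y = A *v y + b)"

definition covariant_preserving ::
    "(real ^ 'n \<Rightarrow> real ^ 'p) \<Rightarrow> real ^ 'n \<Rightarrow> (real ^ 'n \<Rightarrow> real ^ 'p) \<Rightarrow> bool" where
  "covariant_preserving xhat z h \<longleftrightarrow>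
     (\<exists>\<rho>::real. jacobian h (at z) = \<rho> *\<^sub>R jacobian xhat (at z))"

definition coherent_map ::
    "real ^ 'p ^ 'n \<Rightarrow> (real ^ 'n \<Rightarrow> real ^ 'p) \<Rightarrow> real ^ 'n \<Rightarrow> (real ^ 'n \<Rightarrow> real ^ 'p) \<Rightarrow> bool" where
  "coherent_map \<Phi> xhat z h \<longleftrightarrow> h (\<Phi> *v xhat z) = xhat z"

definition refitting_class ::
    "real ^ 'p ^ 'n \<Rightarrow> (real ^ 'n \<Rightarrow> real ^ 'p) \<Rightarrow> real ^ 'n \<Rightarrow> (real ^ 'n \<Rightarrow> real ^ 'p) set" where
  "refitting_class \<Phi> xhat z =
     {h. affine_map h \<and> covariant_preserving xhat z h \<and> coherent_map \<Phi> xhat z h}"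

definition covariant_refitting ::
    "real ^ 'p ^ 'n \<Rightarrow> (real ^ 'n \<Rightarrow> real ^ 'p) \<Rightarrow> real ^ 'n \<Rightarrow> (real ^ 'n \<Rightarrow> real ^ 'p) \<Rightarrow> bool" where
  "covariant_refitting \<Phi> xhat z D \<longleftrightarrow>
     is_arg_min (\<lambda>h. (norm (\<Phi> *v h z - z))\<^sup>2) (\<lambda>h. h \<in> refitting_class \<Phi> xhat z) D"

end

theory Submission
  imports Defs
begin

text \<open>
  Affineness, covariance and coherence force a member of the class to be
  \<open>y \<mapsto> xhat z + r J (y - \<Phi> xhat z)\<close> for a scalar \<open>r\<close>, whose residual at \<open>z\<close> is
  \<open>r v - \<delta>\<close> with \<open>v = \<Phi> J \<delta>\<close>. The scalar \<open>\<rho>\<close> makes \<open>\<rho> v\<close> the orthogonal projection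
  of \<open>\<delta>\<close> onto the line spanned by \<open>v\<close>, so Pythagoras gives the minimum and its uniqueness.
\<close>

lemma jacobian_affine:
  fixes A :: "real ^ 'n ^ 'm"
  shows "jacobian (\<lambda>y. A *v y + b) (at z) = A"
proof -
  have "((\<lambda>y. A *v y + b) has_derivative (*v) A) (at z)"
    by (auto intro!: derivative_eq_intros
        bounded_linear_imp_has_derivative matrix_vector_mul_bounded_linear)
  then have "frechet_derivative (\<lambda>y. A *v y + b) (at z) = (*v) A"
    using frechet_derivative_at by metis
  then show ?thesis
    by (simp add: jacobian_def)
qed

text \<open>The Jacobian of an affine map is its matrix, so covariance leaves only a scalar free in
  the linear part, and coherence then determines the offset. Minimizing over maps thus becomes
  minimizing over a single real \<open>r\<close>.\<close>

lemma refitting_class_eq_range: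
  "refitting_class \<Phi> xhat z =
     range (\<lambda>r y. xhat z + r *\<^sub>R (jacobian xhat (at z) *v (y - \<Phi> *v xhat z)))"
    (is "_ = range ?D")
proof (intro equalityI subsetI)
  fix h
  assume "h \<in> refitting_class \<Phi> xhat z"
  then obtain A b r where "\<forall>y. h y = A *v y + b"
    and cov: "jacobian h (at z) = r *\<^sub>R jacobian xhat (at z)"
    and coh: "h (\<Phi> *v xhat z) = xhat z"
    unfolding refitting_class_def affine_map_def covariant_preserving_def coherent_map_def
    by blast
  then have h: "h = (\<lambda>y. A *v y + b)" by blast
  have A: "A = r *\<^sub>R jacobian xhat (at z)"
    using cov by (simp add: h jacobian_affine)
  have b: "A *v (\<Phi> *v xhat z) + b = xhat z"
    using coh by (simp add: h)
  have "h y = xhat z + A *v (y - \<Phi> *v xhat z)" for y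
    using b by (simp add: h matrix_vector_mult_diff_distrib algebra_simps)
  then have "h = ?D r"
    by (simp add: A scaleR_matrix_vector_assoc fun_eq_iff)
  then show "h \<in> range ?D" by blast
next
  fix h
  assume "h \<in> range ?D"
  then obtain r where h: "h = ?D r" by blast
  define A where "A = r *\<^sub>R jacobian xhat (at z)"
  \<comment> \<open>The offset is the coherence equation solved for \<open>b\<close>.\<close>
  have affine: "h = (\<lambda>y. A *v y + (xhat z - A *v (\<Phi> *v xhat z)))"
    by (simp add: h A_def fun_eq_iff matrix_vector_mult_diff_distrib scaleR_diff_right
        flip: scaleR_matrix_vector_assoc)
  then have "jacobian h (at z) = A"
    by (simp only: jacobian_affine)
  then have "covariant_preserving xhat z h"
    unfolding covariant_preserving_def A_def by blast
  moreover have "affine_map h"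
    unfolding affine_map_def using affine by blast
  moreover have "coherent_map \<Phi> xhat z h"
    by (simp add: coherent_map_def h)
  ultimately show "h \<in> refitting_class \<Phi> xhat z"
    by (simp add: refitting_class_def)
qed

text \<open>Division by zero makes the coefficient \<open>0\<close> when \<open>v = 0\<close>; the identity still holds.\<close>

lemma norm_scaleR_diff_projection:
  fixes v w :: "'a::real_inner"
  defines "c \<equiv> (v \<bullet> w) / (norm v)\<^sup>2"
  shows "(norm (r *\<^sub>R v - w))\<^sup>2 = (norm (c *\<^sub>R v - w))\<^sup>2 + (r - c)\<^sup>2 * (norm v)\<^sup>2"
proof -
  \<comment> \<open>This says that \<open>c *\<^sub>R v - w\<close> is orthogonal to
    \<open>v\<close>, which removes the cross term when the square is expanded.\<close>
  have "v \<bullet> w = c * (v \<bullet> v)"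
    by (cases "v = 0") (simp_all add: c_def power2_norm_eq_inner)
  then show ?thesis
    unfolding power2_norm_eq_inner
    by (simp add: inner_diff_left inner_diff_right inner_commute[of w v])
       (simp add: power2_eq_square algebra_simps)
qed

theorem theorem6:
  fixes \<Phi> :: "real ^ 'p ^ 'n"
    and z :: "real ^ 'n"
    and xhat :: "real ^ 'n \<Rightarrow> real ^ 'p"
    and J :: "real ^ 'n ^ 'p"
    and \<delta> :: "real ^ 'n"
    and \<rho> :: real
  assumes diff: "xhat differentiable (at z)"
    and J_eq: "J = jacobian xhat (at z)"
    and \<delta>_eq: "\<delta> = z - \<Phi> *v xhat z"
    and \<rho>_eq: "\<rho> = (if \<Phi> *v (J *v \<delta>) \<noteq> 0
                    then ((\<Phi> *v (J *v \<delta>)) \<bullet> \<delta>) / (norm (\<Phi> *v (J *v \<delta>)))\<^sup>2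
                    else 1)"
  shows "(\<exists>D. covariant_refitting \<Phi> xhat z D)
       \<and> (\<Phi> *v (J *v \<delta>) \<noteq> 0 \<longrightarrow> (\<exists>!D. covariant_refitting \<Phi> xhat z D))
       \<and> covariant_refitting \<Phi> xhat z (\<lambda>y. xhat z + \<rho> *\<^sub>R (J *v (y - \<Phi> *v xhat z)))
       \<and> (\<Phi> *v (J *v \<delta>) \<noteq> 0 \<longrightarrow>
            (\<forall>D. covariant_refitting \<Phi> xhat z D \<longrightarrow>
               (\<forall>y. D y = xhat z + \<rho> *\<^sub>R (J *v (y - \<Phi> *v xhat z)))))"
proof -
  let ?v = "\<Phi> *v (J *v \<delta>)"
  let ?D = "\<lambda>r y. xhat z + r *\<^sub>R (J *v (y - \<Phi> *v xhat z))"
  have range_D: "refitting_class \<Phi> xhat z = range ?D"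
    by (simp add: refitting_class_eq_range J_eq)
  have residual: "\<Phi> *v ?D r z - z = r *\<^sub>R ?v - \<delta>" for r
    by (simp add: \<delta>_eq matrix_vector_right_distrib matrix_vector_mult_scaleR)
  \<comment> \<open>If \<open>?v = 0\<close>, then \<rho> is 1 rather than the quotient's value 0,
    but the residual is -\<delta> for every \<open>r\<close>, so the identity survives.\<close>
  have pythagoras: "(norm (\<Phi> *v ?D r z - z))\<^sup>2 =
      (norm (\<Phi> *v ?D \<rho> z - z))\<^sup>2 + (r - \<rho>)\<^sup>2 * (norm ?v)\<^sup>2" for r
    unfolding residual
    using norm_scaleR_diff_projection[of r ?v \<delta>] by (cases "?v = 0") (simp_all add: \<rho>_eq)
  have "(norm (\<Phi> *v ?D \<rho> z - z))\<^sup>2 \<le> (norm (\<Phi> *v ?D r z - z))\<^sup>2" for r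
    by (subst pythagoras[of r]) simp
  then have minimizer: "covariant_refitting \<Phi> xhat z (?D \<rho>)"
    unfolding covariant_refitting_def is_arg_min_linorder range_D
    by blast
  have unique: "D = ?D \<rho>" if v: "?v \<noteq> 0" and D: "covariant_refitting \<Phi> xhat z D" for D
  proof -
    obtain r where r: "D = ?D r"
      using D by (auto simp: covariant_refitting_def is_arg_min_def range_D)
    have "(norm (\<Phi> *v ?D r z - z))\<^sup>2 \<le> (norm (\<Phi> *v ?D \<rho> z - z))\<^sup>2"
      using D unfolding covariant_refitting_def is_arg_min_linorder range_D r by blast
    \<comment> \<open>Pythagoras turns the minimality of \<open>?D r\<close> into a bound on the
      excess term; as \<open>?v\<close> is nonzero, this forces \<open>r = \<rho>\<close>.\<close>
    then have "(r - \<rho>)\<^sup>2 * (norm ?v)\<^sup>2 \<le> 0"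
      unfolding pythagoras[of r] by simp
    with v have "r = \<rho>"
      by (simp add: mult_le_0_iff)
    with r show ?thesis by simp
  qed
  show ?thesis
    using minimizer unique by (intro conjI impI allI ex1I[of _ "?D \<rho>"]) (blast, blast, blast, blast, metis)
qed

end
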